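(* Let $P,Q$ be integers and let $(U_n(P,Q))_{n\ge 0}$ be the Lucas sequence of the first type. Suppose $P$ is odd, $n$ is odd with $n \ge 3$, and $Q \equiv 2 \pmod 4$. Then $U_n(P,Q)$ is not a non-zero perfect square, i.e. there is no nonzero integer $m$ with $U_n(P,Q)=m^2$.
   Context: For fixed integers $P,Q$, the Lucas sequence of the first type is defined by $U_0(P,Q)=0$, $U_1(P,Q)=1$, and $U_n(P,Q)=P\cdot U_{n-1}(P,Q)-Q\cdot U_{n-2}(P,Q)$ for $n\ge 2$. *)

theory Defs
  imports "HOL-Number_Theory.Cong"
begin

fun lucas_U :: "int \<Rightarrow> int \<Rightarrow> nat \<Rightarrow> int" where
  "lucas_U P Q 0 = 0"
| "lucas_U P Q (Suc 0) = 1"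
| "lucas_U P Q (Suc (Suc n)) = P * lucas_U P Q (Suc n) - Q * lucas_U P Q n"

end

theory Submission
  imports Defs
begin

text \<open>Modulo 4 the sequence is constant along each parity from index 2 on: the even-indexed
  terms are congruent to \<open>P\<close> and the odd-indexed ones to 3, which is not a square modulo 4.\<close>

text \<open>Shaped like the right-hand side of the Lucas recurrence, so that each inductive step can
  reduce all its factors at once.\<close>

lemma mult_diff_mult_cong:
  fixes a b c d :: int
  assumes "[a = a'] (mod m)" "[b = b'] (mod m)" "[c = c'] (mod m)" "[d = d'] (mod m)"
  shows "[a * b - c * d = a' * b' - c' * d'] (mod m)"
  using assms by (intro cong_diff cong_mult)

lemma odd_square_cong_1_mod_4:
  fixes a :: int
  assumes "odd a"
  shows "[a * a = 1] (mod 4)"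
proof -
  obtain k where "a = 2 * k + 1" using assms by (elim oddE)
  then have "a * a - 1 = 4 * (k * k + k)" by (simp add: algebra_simps)
  then show ?thesis by (simp add: cong_iff_dvd_diff)
qed

text \<open>The recurrence has order two, so both parities go through the induction together. The
  pattern starts at index 2: the initial values 0 and 1 are not congruent to \<open>P\<close> and
  3.\<close>

lemma lucas_U_mod_4:
  assumes "odd P" and Q: "[Q = 2] (mod 4)"
  shows "[lucas_U P Q (2 * k + 2) = P] (mod 4) \<and> [lucas_U P Q (2 * k + 3) = 3] (mod 4)"
proof -
  have PP: "[P * P = 1] (mod 4)" using assms(1) by (rule odd_square_cong_1_mod_4)
  show ?thesis
  proof (induction k)
    case 0
    have "[P * P - Q = 1 - 2] (mod 4)" using PP Q by (rule cong_diff)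
    also have "[1 - 2 = 3 :: int] (mod 4)" by (simp add: cong_def)
    finally show ?case by (simp add: numeral_eq_Suc)
  next
    case (Suc k)
    let ?U = "lucas_U P Q"
    \<comment> \<open>The right-hand side equals \<open>P\<close> exactly, since 3P - 2P =
      P.\<close>
    have "[P * ?U (2 * k + 3) - Q * ?U (2 * k + 2) = P * 3 - 2 * P] (mod 4)"
      using Suc Q by (intro mult_diff_mult_cong) auto
    then have even: "[?U (2 * Suc k + 2) = P] (mod 4)"
      by (simp add: numeral_eq_Suc)
    \<comment> \<open>The even-indexed term just computed contributes a second factor
      \<open>P\<close>, and the square of an odd number is 1 modulo 4.\<close>
    have "[P * ?U (2 * Suc k + 2) - Q * ?U (2 * k + 3) = P * P - 2 * 3] (mod 4)"
      using Suc Q even by (intro mult_diff_mult_cong) auto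
    also have "[P * P - 2 * 3 = 1 - 2 * 3] (mod 4)" using PP by (intro cong_diff) auto
    also have "[1 - 2 * 3 = 3 :: int] (mod 4)" by (simp add: cong_def)
    finally have "[?U (2 * Suc k + 3) = 3] (mod 4)"
      by (simp add: numeral_eq_Suc)
    with even show ?case ..
  qed
qed

text \<open>By parity, squares are only 0 or 1 modulo 4.\<close>

lemma square_not_cong_3_mod_4:
  fixes m :: int
  shows "\<not> [m\<^sup>2 = 3] (mod 4)"
proof (cases "even m")
  case True
  then have "[m\<^sup>2 = 0] (mod 4)" by (auto simp: cong_def power2_eq_square)
  then show ?thesis by (simp add: cong_def)
next
  case False
  then have "[m\<^sup>2 = 1] (mod 4)" using odd_square_cong_1_mod_4 by (simp add: power2_eq_square)
  then show ?thesis by (simp add: cong_def)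
qed

theorem theorem3p2:
  fixes P Q :: int and n :: nat
  assumes "odd P" and "odd n" and "n \<ge> 3" and "[Q = 2] (mod 4)"
  shows "\<not> (\<exists>m::int. m \<noteq> 0 \<and> lucas_U P Q n = m\<^sup>2)"
proof -
  obtain k where "n = 2 * k + 3"
  proof -
    obtain j where "n = 2 * j + 1" using \<open>odd n\<close> by (elim oddE)
    \<comment> \<open>Here n \<ge> 3 forces j \<ge> 1, so the natural-number subtraction does not
      truncate.\<close>
    with \<open>n \<ge> 3\<close> have "n = 2 * (j - 1) + 3" by simp
    then show thesis by (rule that)
  qed
  then have "[lucas_U P Q n = 3] (mod 4)" using lucas_U_mod_4 assms by blast
  then show ?thesis using square_not_cong_3_mod_4 by metis
qed

end
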